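(* Let $d=1$ and let $n\ge1$ be an integer. Then the best constant $K_1(n)$ in the remainder term of the inequality $$\|u\|^2_{C(\mathbb T^1)}\le c_1(n)\,\|u\|_{L^2}^{2-1/n}\,\|(-\Delta)^{n/2}u\|_{L^2}^{1/n}-K_1(n)\,\|u\|^2_{L^2}\qquad (u\in H^n(\mathbb T^1),\ \textstyle\int_{\mathbb T^1} u\,dx=0)$$ is strictly positive: $K_1(n)>0$.
   Context: $\mathbb T^1=\mathbb R/2\pi\mathbb Z$ with Lebesgue measure. $c_1(n)=\frac{1}{\sin(\frac{\pi}{2n})\,(2n-1)^{1-1/(2n)}}$. The best constant is $K_1(n)=\inf_{\delta\ge1}\{c_1(n)\delta^{1/(2n)}-\Theta_{1,n}(\delta)\}$, where for $\delta\ge1$ $$\Theta_{1,n}(\delta)=\sup\Big\{\|u\|_{C(\mathbb T^1)}^2:\ u\in H^n(\mathbb T^1),\ \int_{\mathbb T^1}u\,dx=0,\ \|u\|_{L^2}=1,\ \|(-\Delta)^{n/2}u\|_{L^2}^2=\delta\Big\}.$$ Here $(-\Delta)^{n/2}$ is the Fourier multiplier $|k|^n$, so that $\|(-\Delta)^{n/2}u\|_{L^2}=\|u^{(n)}\|_{L^2}$. *)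

theory Defs
  imports "HOL-Analysis.Analysis"
begin

text \<open>
  Functions on the torus \<open>\<real> / 2\<pi>\<int>\<close> are represented by complex-valued \<open>2\<pi>\<close>-periodic functions
  on the real line; the measure is the (unnormalised) Lebesgue measure of total mass \<open>2\<pi>\<close>.
\<close>

definition periodic_2pi :: "(real \<Rightarrow> complex) \<Rightarrow> bool" where
  "periodic_2pi u \<longleftrightarrow> (\<forall>x. u (x + 2 * pi) = u x)"

abbreviation torus_measure :: "real measure" where
  "torus_measure \<equiv> lebesgue_on {0..2 * pi}"

definition L2_torus :: "(real \<Rightarrow> complex) set" where
  "L2_torus = {u. periodic_2pi u \<and> u \<in> borel_measurable torus_measure \<and>
     integrable torus_measure (\<lambda>x. (cmod (u x))\<^sup>2)}"

definition L2_norm_torus :: "(real \<Rightarrow> complex) \<Rightarrow> real" where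
  "L2_norm_torus u = sqrt (integral\<^sup>L torus_measure (\<lambda>x. (cmod (u x))\<^sup>2))"

definition C_torus :: "(real \<Rightarrow> complex) set" where
  "C_torus = {u. periodic_2pi u \<and> continuous_on UNIV u}"

definition C_norm_torus :: "(real \<Rightarrow> complex) \<Rightarrow> real" where
  "C_norm_torus u = (SUP x. cmod (u x))"

definition fourier_coeff :: "(real \<Rightarrow> complex) \<Rightarrow> int \<Rightarrow> complex" where
  "fourier_coeff u k =
     integral\<^sup>L torus_measure (\<lambda>x. u x * cis (- (of_int k * x))) / of_real (2 * pi)"

text \<open>
  \<open>w\<close> is \<open>(-\<Delta>)\<^sup>n\<^sup>/\<^sup>2 u\<close>, the image of \<open>u\<close> under the Fourier multiplier \<open>\<bar>k\<bar>\<^sup>n\<close>. Elements of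
  \<open>L\<^sup>2\<close> are determined by their Fourier coefficients up to null sets, so \<open>w\<close> is unique almost
  everywhere and the choice below does not affect norms.
\<close>

definition is_frac_laplacian :: "nat \<Rightarrow> (real \<Rightarrow> complex) \<Rightarrow> (real \<Rightarrow> complex) \<Rightarrow> bool" where
  "is_frac_laplacian n u w \<longleftrightarrow>
     w \<in> L2_torus \<and> (\<forall>k. fourier_coeff w k = of_int (\<bar>k\<bar> ^ n) * fourier_coeff u k)"

definition frac_laplacian :: "nat \<Rightarrow> (real \<Rightarrow> complex) \<Rightarrow> (real \<Rightarrow> complex)" where
  "frac_laplacian n u = (SOME w. is_frac_laplacian n u w)"

text \<open>
  \<open>H\<^sup>n\<close> consists of the \<open>u \<in> L\<^sup>2\<close> with \<open>(-\<Delta>)\<^sup>n\<^sup>/\<^sup>2 u \<in> L\<^sup>2\<close>, i.e. with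
  square-summable \<open>\<bar>k\<bar>\<^sup>n \<bar>fourier_coeff u k\<bar>\<close>.
\<close>

definition H_torus :: "nat \<Rightarrow> (real \<Rightarrow> complex) set" where
  "H_torus n = {u \<in> L2_torus. \<exists>w. is_frac_laplacian n u w}"

definition c1 :: "nat \<Rightarrow> real" where
  "c1 n = 1 / (sin (pi / (2 * real n)) * (2 * real n - 1) powr (1 - 1 / (2 * real n)))"

text \<open>
  For \<open>n \<ge> 1\<close> each almost-everywhere class in \<open>H\<^sup>n\<close> contains exactly one continuous function, and
  the \<open>C\<close>-norm of the class is the maximum norm of that function; hence \<open>u\<close> ranges over the
  continuous representatives.
\<close>

definition Theta1 :: "nat \<Rightarrow> real \<Rightarrow> real" where
  "Theta1 n \<delta> = Sup {(C_norm_torus u)\<^sup>2 | u.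
     u \<in> H_torus n \<and> u \<in> C_torus \<and>
     integral\<^sup>L torus_measure u = 0 \<and>
     L2_norm_torus u = 1 \<and>
     (L2_norm_torus (frac_laplacian n u))\<^sup>2 = \<delta>}"

definition K1 :: "nat \<Rightarrow> real" where
  "K1 n = (INF \<delta>\<in>{1..}. c1 n * \<delta> powr (1 / (2 * real n)) - Theta1 n \<delta>)"

end

theory Submission
  imports Defs "HOL-Library.Periodic_Fun"
begin

text \<open>
  The sharp inequality comes from estimating \<open>\<bar>u x\<bar>\<close> by the sum of the moduli of the Fourier coefficients
  and applying Cauchy-Schwarz with the weights \<open>\<bar>k\<bar>\<^sup>2\<^sup>n + \<kappa>\<close>. Together with Bessel's inequality this
  bounds the square of the maximum norm by

  \<open>(\<delta> + \<kappa>) / (2 pi) * (\<Sum>k\<noteq>0. 1 / (\<bar>k\<bar>\<^sup>2\<^sup>n + \<kappa>))\<close>.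

  If the sum is replaced by the integral over the line, the choice \<open>\<kappa> = (2n - 1) \<delta>\<close> gives exactly
  \<open>c1 n * \<delta> powr (1 / (2n))\<close>. The mean-zero condition removes the term \<open>k = 0\<close>, so that the sum is a
  right-endpoint Riemann sum of a decreasing function on each half-line and is strictly smaller than the integral.
  The point is that the loss is of order \<open>1 / \<kappa>\<close>, the size of the missing term, and so survives
  multiplication by \<open>\<delta> + \<kappa>\<close>, uniformly in \<open>\<delta> \<ge> 1\<close> (\<open>sum_le_integral_minus_gap\<close>,
  \<open>lattice_sum_bound\<close>). Hence the infimum in \<open>K1\<close> is bounded below by a positive constant.

  Two facts from Fourier analysis are needed besides Bessel's inequality: a continuous function is bounded by
  the sum of the moduli of its coefficients (\<open>cmod_le_sum_fourier_coeff\<close>), and square-integrable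
  functions with equal coefficients have equal norms (\<open>L2_norm_torus_eqI\<close>), which shows that the
  supremum in \<open>Theta1\<close> is over a nonempty set (\<open>admissible_function_exists\<close>). Both follow from the
  vanishing almost everywhere of an integrable function all of whose Fourier coefficients are zero
  (\<open>trig_orthogonal_AE_zero\<close>).
\<close>

section \<open>Lattice sums against the Beta integral\<close>

text \<open>
  Up to the substitution \<open>t = 1 / (1 + x\<^sup>m)\<close> this is the classical integral of
  \<open>1 / (1 + x\<^sup>m)\<close> over the half-line; the sine in \<open>c1\<close> enters here, through the
  reflection formula.
\<close>

lemma Beta_sine:
  fixes m :: nat assumes "m \<ge> 2"
  shows "Beta (1 - 1 / real m) (1 + 1 / real m) = (pi / m) / sin (pi / m)"
proof -
  define y where "y = 1 / real m"
  have y: "0 < y" "y < 1" using assms by (auto simp: y_def)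
  have nonpos: "y \<notin> \<int>\<^sub>\<le>\<^sub>0" using y by (auto elim!: nonpos_Ints_cases)
  have one_minus: "1 - complex_of_real y = of_real (1 - y)" by simp
  have "complex_of_real (Gamma y * Gamma (1 - y)) = Gamma (of_real y) * Gamma (1 - of_real y)"
    unfolding one_minus Gamma_complex_of_real by simp
  also have "\<dots> = of_real pi / sin (of_real (pi * y))"
    by (subst Gamma_reflection_complex) simp
  also have "\<dots> = of_real (pi / sin (pi * y))"
    by (simp flip: sin_of_real)
  finally have "complex_of_real (Gamma y * Gamma (1 - y)) = of_real (pi / sin (pi * y))" .
  then have refl: "Gamma y * Gamma (1 - y) = pi / sin (pi * y)"
    by (simp only: of_real_eq_iff)
  have "Beta (1 - y) (y + 1) = y * Beta (1 - y) y"
    using Beta_plus1_right[of y "1 - y"] y nonpos by simp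
  also have "Beta (1 - y) y = pi / sin (pi * y)"
    using refl by (simp add: Beta_def mult.commute)
  finally show ?thesis by (simp add: y_def add.commute)
qed

text \<open>
  A Riemann sum of the decreasing function \<open>x \<mapsto> 1 / (1 + (x / \<nu>)\<^sup>m)\<close> lies below its integral.
  Slicing the area under the graph horizontally avoids the improper integral: at height \<open>t\<close> the
  graph has width \<open>h t = \<nu> * ((1 - t) / t) powr (1 / m)\<close>, the sum contributes
  \<open>\<lfloor>h t\<rfloor>\<close> or less, and the integral of \<open>h\<close> over the heights in \<open>[0, 1]\<close> is a Beta integral.
\<close>

lemma sum_le_layer_cake:
  fixes m N :: nat and \<nu> :: real
  assumes m: "m \<ge> 2" and \<nu>: "\<nu> > 0"
  shows "(\<Sum>j<N. 1 / (1 + (real (Suc j) / \<nu>) ^ m)) \<le> \<nu> * ((pi / m) / sin (pi / m))"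
proof -
  define G where "G j = 1 / (1 + (real (Suc j) / \<nu>) ^ m)" for j
  have G: "0 < G j" "G j \<le> 1" for j
    using \<nu> by (auto simp: G_def add_pos_nonneg)
  define h where "h t = \<nu> * (t powr (- (1 / m)) * (1 - t) powr (1 / m))" for t :: real
  have "((\<lambda>t. t powr ((1 - 1 / m) - 1) * (1 - t) powr ((1 + 1 / m) - 1)) has_integral
      Beta (1 - 1 / real m) (1 + 1 / real m)) {0..1}"
    using m by (intro has_integral_Beta_real) (auto simp: add_pos_nonneg)
  then have "(h has_integral \<nu> * ((pi / m) / sin (pi / m))) {0..1}"
    unfolding Beta_sine[OF m] h_def by (intro has_integral_mult_right) simp
  \<comment> \<open>The convention \<open>0 powr a = 0\<close> gives \<open>h 0 = 0\<close>, whereas the sum counts all \<open>N\<close> terms at height \<open>0\<close>.\<close>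
  then have h: "((\<lambda>t. if t = 0 then real N else h t) has_integral \<nu> * ((pi / m) / sin (pi / m))) {0..1}"
    by (rule has_integral_spike_finite[of "{0}", rotated 2]) auto
  have "((\<lambda>t. if t \<in> {0..G j} then 1 else 0) has_integral G j) {0..1}" for j
    using has_integral_restrict[of "{0..G j}" "{0..1}" "\<lambda>_. 1::real" "G j"]
      has_integral_const_real[of "1::real" 0 "G j"] G[of j] by auto
  then have s: "((\<lambda>t. \<Sum>j<N. if t \<in> {0..G j} then 1 else 0) has_integral (\<Sum>j<N. G j)) {0..1}"
    by (intro has_integral_sum) auto
  have "(\<Sum>j<N. G j) \<le> \<nu> * ((pi / m) / sin (pi / m))"
  proof (rule has_integral_le[OF s h])
    fix t :: real assume t: "t \<in> {0..1}"
    have card: "(\<Sum>j<N. if t \<in> {0..G j} then 1 else 0) = real (card {j \<in> {..<N}. t \<le> G j})"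
      using t by (auto simp flip: sum.inter_filter)
    show "(\<Sum>j<N. if t \<in> {0..G j} then 1 else 0) \<le> (if t = 0 then real N else h t)"
    proof (cases "t = 0")
      case True
      have "card {j \<in> {..<N}. t \<le> G j} \<le> card {..<N}" by (intro card_mono) auto
      then show ?thesis unfolding card using True by simp
    next
      case False
      then have t: "0 < t" "t \<le> 1" using t by auto
      have "real (Suc j) \<le> h t" if "t \<le> G j" for j
      proof -
        have "(real (Suc j) / \<nu>) ^ m \<le> (1 - t) / t"
        proof -
          have p: "0 < 1 + (real (Suc j) / \<nu>) ^ m" using \<nu> by (intro add_pos_nonneg) auto
          have "t * (1 + (real (Suc j) / \<nu>) ^ m) \<le> 1"
            using that p unfolding G_def by (simp only: pos_le_divide_eq)
          then show ?thesis using t by (simp add: field_simps)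
        qed
        then have "((real (Suc j) / \<nu>) ^ m) powr (1 / m) \<le> ((1 - t) / t) powr (1 / m)"
          using \<nu> by (intro powr_mono2) auto
        also have "((real (Suc j) / \<nu>) ^ m) powr (1 / m) = real (Suc j) / \<nu>"
          using \<nu> m by (simp add: powr_powr flip: powr_realpow)
        also have "((1 - t) / t) powr (1 / m) = t powr (- (1 / m)) * (1 - t) powr (1 / m)"
          using t by (simp add: powr_divide powr_minus_divide)
        finally show ?thesis using \<nu> by (simp add: h_def field_simps)
      qed
      then have "{j \<in> {..<N}. t \<le> G j} \<subseteq> {..<nat \<lfloor>h t\<rfloor>}"
        by (smt (verit, best) lessThan_iff mem_Collect_eq of_nat_floor subsetI Suc_le_eq le_nat_floor)
      then have "card {j \<in> {..<N}. t \<le> G j} \<le> card {..<nat \<lfloor>h t\<rfloor>}"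
        by (intro card_mono) auto
      moreover have "0 \<le> h t" using \<nu> by (simp add: h_def)
      ultimately have "real (card {j \<in> {..<N}. t \<le> G j}) \<le> h t"
        by (simp add: of_nat_floor) linarith
      then show ?thesis unfolding card using False by simp
    qed
  qed
  then show ?thesis by (simp add: G_def)
qed

lemma power_midpoint_le:
  fixes q r :: real assumes "0 \<le> q" "0 \<le> r"
  shows "((q + r) / 2) ^ m \<le> (q ^ m + r ^ m) / 2"
proof -
  have "convex_on {0..} (\<lambda>x::real. x ^ m)"
    using convex_power_odd convex_on_subset[OF convex_power_even, of m "{0..}"] by (cases "even m") auto
  from convex_onD[OF this, of "1 / 2" q r] show ?thesis
    using assms by (simp add: add_divide_distrib)
qed

text \<open>
  The loss in the Riemann sum with step \<open>1\<close> stays bounded away from \<open>0\<close> as \<open>\<mu>\<close> grows. The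
  sum with step \<open>1/2\<close> is still below the integral, and it exceeds the sum with step \<open>1\<close> by half
  the total drop of the summand \<open>G\<close> over the right halves of the unit intervals. For arguments up to \<open>\<mu>\<close>
  the denominators of \<open>G\<close> are at most \<open>2\<close>, and by convexity of the power the right half of an interval
  carries at least half of the increase of \<open>(x / \<mu>)\<^sup>m\<close>; these increases telescope to
  \<open>(\<lfloor>\<mu>\<rfloor> / \<mu>)\<^sup>m \<ge> (1/2)\<^sup>m\<close>.
\<close>

lemma sum_le_integral_minus_gap:
  fixes m N :: nat and \<mu> :: real
  assumes m: "m \<ge> 2" and \<mu>: "\<mu> \<ge> 1"
  shows "(\<Sum>k<N. 1 / (1 + (real (Suc k) / \<mu>) ^ m)) \<le> \<mu> * ((pi / m) / sin (pi / m)) - (1 / 2) ^ m / 16"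
proof -
  define G where "G x = 1 / (1 + (x / \<mu>) ^ m)" for x
  have den: "0 < 1 + (x / \<mu>) ^ m" if "x \<ge> 0" for x using \<mu> that by (intro add_pos_nonneg) auto
  have G0: "0 \<le> G x" if "x \<ge> 0" for x using den[OF that] by (simp add: G_def)
  have Gdec: "G y \<le> G x" if "0 \<le> x" "x \<le> y" for x y
    using that \<mu> den unfolding G_def
    by (intro divide_left_mono mult_pos_pos add_left_mono power_mono divide_right_mono) auto
  define M where "M = nat \<lfloor>\<mu>\<rfloor>"
  have "real M = of_int \<lfloor>\<mu>\<rfloor>" using \<mu> by (simp add: M_def)
  moreover have "1 \<le> \<lfloor>\<mu>\<rfloor>" using \<mu> by simp
  ultimately have "1 \<le> real M" "\<mu> < real M + 1" "real M \<le> \<mu>"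
    by linarith+
  then have M: "1 \<le> M" "real M \<le> \<mu>" "\<mu> / 2 \<le> real M"
    by auto
  \<comment> \<open>The partial sums increase with \<open>N\<close>, so the sum may be extended to reach \<open>\<mu>\<close>, where the gap arises.\<close>
  define L where "L = max N M"
  have drop: "((real (Suc k) / \<mu>) ^ m - (real k / \<mu>) ^ m) / 8 \<le> G (real k + 1 / 2) - G (real (Suc k))"
    if "k < M" for k
  proof -
    define q s r where "q = real k / \<mu>" and "s = (real k + 1 / 2) / \<mu>" and "r = real (Suc k) / \<mu>"
    have r: "0 \<le> s" "s \<le> r" "r \<le> 1" "s = (q + r) / 2" "0 \<le> q"
      using \<mu> M that by (auto simp: q_def r_def s_def field_simps)
    have p: "0 \<le> s ^ m" "s ^ m \<le> r ^ m" "r ^ m \<le> 1"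
      using r by (auto intro: power_mono power_le_one)
    have half: "(r ^ m - q ^ m) / 2 \<le> r ^ m - s ^ m"
    proof -
      have "((q + r) / 2) ^ m \<le> (q ^ m + r ^ m) / 2"
        using r by (intro power_midpoint_le) linarith+
      then show ?thesis unfolding r(4) by (simp add: diff_divide_distrib add_divide_distrib)
    qed
    have "(r ^ m - s ^ m) / 4 \<le> (r ^ m - s ^ m) / ((1 + s ^ m) * (1 + r ^ m))"
      using p mult_mono[of "1 + s ^ m" 2 "1 + r ^ m" 2] by (intro divide_left_mono) auto
    also have "\<dots> = 1 / (1 + s ^ m) - 1 / (1 + r ^ m)"
      using p by (simp add: diff_frac_eq)
    finally have "(r ^ m - s ^ m) / 4 \<le> 1 / (1 + s ^ m) - 1 / (1 + r ^ m)" .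
    moreover have "(r ^ m - q ^ m) / 8 \<le> (r ^ m - s ^ m) / 4" using half by simp
    ultimately show ?thesis unfolding G_def q_def r_def s_def by (rule order_trans[rotated])
  qed
  have "(1 / 2) ^ m \<le> (real M / \<mu>) ^ m"
    using M \<mu> by (intro power_mono) (auto simp: field_simps)
  also have "\<dots> = (\<Sum>k<M. (real (Suc k) / \<mu>) ^ m - (real k / \<mu>) ^ m)"
    using m by (subst sum_lessThan_telescope) auto
  finally have "(1 / 2) ^ m / 8 \<le> (\<Sum>k<M. ((real (Suc k) / \<mu>) ^ m - (real k / \<mu>) ^ m) / 8)"
    by (simp add: sum_divide_distrib[symmetric])
  also have "\<dots> \<le> (\<Sum>k<M. G (real k + 1 / 2) - G (real (Suc k)))"
    by (intro sum_mono drop) auto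
  also have "\<dots> \<le> (\<Sum>k<L. G (real k + 1 / 2) - G (real (Suc k)))"
    by (intro sum_mono2) (auto simp: L_def intro!: Gdec)
  finally have gap: "(1 / 2) ^ m / 8 \<le> (\<Sum>k<L. G (real k + 1 / 2)) - (\<Sum>k<L. G (real (Suc k)))"
    by (simp add: sum_subtractf)
  have "(\<Sum>j<2 * L. G (real (Suc j) / 2)) = (\<Sum>k<L. G (real k + 1 / 2)) + (\<Sum>k<L. G (real (Suc k)))"
    by (induction L) (auto simp: algebra_simps add_divide_distrib)
  moreover have "(\<Sum>j<2 * L. G (real (Suc j) / 2)) \<le> 2 * \<mu> * ((pi / m) / sin (pi / m))"
    using sum_le_layer_cake[OF m, of "2 * \<mu>" "2 * L"] \<mu> by (simp add: G_def)
  ultimately have "(\<Sum>k<L. G (real (Suc k))) \<le> \<mu> * ((pi / m) / sin (pi / m)) - (1 / 2) ^ m / 16"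
    using gap by linarith
  moreover have "(\<Sum>k<N. G (real (Suc k))) \<le> (\<Sum>k<L. G (real (Suc k)))"
    using G0 by (intro sum_mono2) (auto simp: L_def)
  ultimately show ?thesis by (simp add: G_def)
qed

text \<open>
  The weight parameter \<open>\<kappa> = (2n - 1) \<delta>\<close> minimises the product of \<open>(\<delta> + \<kappa>) / (2 pi)\<close> with the integral of
  \<open>1 / (x\<^sup>2\<^sup>n + \<kappa>)\<close> over the line, and the minimum is precisely the leading term \<open>c1 n * \<delta> powr (1 / (2n))\<close>.
  The sum is smaller than the integral by order \<open>1 / \<kappa>\<close> while \<open>\<delta> + \<kappa>\<close> is proportional to \<open>\<kappa>\<close>, so the
  gain does not depend on \<open>\<delta>\<close>.
\<close>

lemma lattice_sum_bound:
  fixes n N :: nat and \<delta> :: real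
  assumes n: "n \<ge> 1" and \<delta>: "\<delta> \<ge> 1"
  defines "m \<equiv> 2 * n"
  defines "\<kappa> \<equiv> (real m - 1) * \<delta>"
  shows "(\<delta> + \<kappa>) / (2 * pi) * (2 * (\<Sum>k<N. 1 / (real (Suc k) ^ m + \<kappa>)))
    \<le> c1 n * \<delta> powr (1 / (2 * real n)) - real m / ((real m - 1) * pi) * ((1 / 2) ^ m / 16)"
proof -
  have m: "m \<ge> 2" using n by (simp add: m_def)
  have m1: "real m - 1 \<ge> 1" using m by simp
  have \<kappa>: "\<kappa> \<ge> 1" using m1 \<delta> unfolding \<kappa>_def by (metis mult_mono' mult_1 zero_le_one)
  define \<mu> where "\<mu> = \<kappa> powr (1 / m)"
  have \<mu>: "\<mu> \<ge> 1" using \<kappa> by (simp add: \<mu>_def ge_one_powr_ge_zero)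
  have \<mu>m: "\<mu> ^ m = \<kappa>" using \<kappa> m by (simp add: \<mu>_def powr_powr flip: powr_realpow)
  have sin: "sin (pi / m) > 0" using m by (intro sin_gt_zero) (auto simp: field_simps)
  have "real (Suc k) ^ m + \<kappa> = (1 + (real (Suc k) / \<mu>) ^ m) * \<kappa>" for k
    using \<kappa> by (simp add: power_divide \<mu>m distrib_right)
  then have sum: "(\<Sum>k<N. 1 / (real (Suc k) ^ m + \<kappa>)) = (\<Sum>k<N. 1 / (1 + (real (Suc k) / \<mu>) ^ m)) / \<kappa>"
    by (simp add: sum_divide_distrib)
  have eq: "\<delta> + \<kappa> = \<kappa> * (real m / (real m - 1))"
    using m1 by (simp add: \<kappa>_def field_simps)
  have "(\<delta> + \<kappa>) / (2 * pi) * (2 * (\<Sum>k<N. 1 / (real (Suc k) ^ m + \<kappa>)))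
      = real m / ((real m - 1) * pi) * (\<Sum>k<N. 1 / (1 + (real (Suc k) / \<mu>) ^ m))"
    unfolding sum eq using \<kappa> by simp
  also have "\<dots> \<le> real m / ((real m - 1) * pi) * (\<mu> * ((pi / m) / sin (pi / m)) - (1 / 2) ^ m / 16)"
    using m1 by (intro mult_left_mono sum_le_integral_minus_gap m \<mu>) auto
  also have "\<dots> = \<mu> / ((real m - 1) * sin (pi / m)) - real m / ((real m - 1) * pi) * ((1 / 2) ^ m / 16)"
    using m1 sin m by (simp add: right_diff_distrib)
  also have "\<mu> / ((real m - 1) * sin (pi / m)) = c1 n * \<delta> powr (1 / (2 * real n))"
  proof -
    have "\<mu> = (real m - 1) powr (1 / m) * \<delta> powr (1 / m)"
      using m1 \<delta> by (simp add: \<mu>_def \<kappa>_def powr_mult)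
    moreover have "(real m - 1) powr (1 - 1 / m) = (real m - 1) / (real m - 1) powr (1 / m)"
      using m1 by (simp add: powr_diff)
    ultimately show ?thesis using m1 by (simp add: c1_def m_def)
  qed
  finally show ?thesis .
qed

section \<open>Trigonometric polynomials and Bessel's inequality\<close>

abbreviation trig :: "int \<Rightarrow> real \<Rightarrow> complex" where
  "trig k x \<equiv> cis (of_int k * x)"

definition trig_poly :: "int set \<Rightarrow> (int \<Rightarrow> complex) \<Rightarrow> real \<Rightarrow> complex" where
  "trig_poly K c x = (\<Sum>k\<in>K. c k * trig k x)"

lemma trig_add_2pi: "trig k (x + 2 * pi) = trig k x"
proof -
  have "cis (of_int k * (2 * pi)) = 1"
    using cis_multiple_2pi[of "of_int k"] by (simp add: mult.commute)
  then show ?thesis by (simp add: distrib_left flip: cis_mult)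
qed

lemma continuous_on_trig [continuous_intros]: "continuous_on A (trig k)"
  by (intro continuous_intros)

lemma continuous_on_trig_poly [continuous_intros]: "continuous_on A (trig_poly K c)"
  unfolding trig_poly_def by (intro continuous_intros)

lemma trig_borel [measurable]: "trig k \<in> borel_measurable torus_measure"
  by (intro borel_measurable_integrable continuous_imp_integrable_real continuous_intros)

lemma periodic_trig_poly: "periodic_2pi (trig_poly K c)"
  by (simp add: periodic_2pi_def trig_poly_def trig_add_2pi)

lemma integrable_continuous_torus:
  fixes f :: "real \<Rightarrow> 'b::euclidean_space"
  assumes "continuous_on UNIV f"
  shows "integrable torus_measure f"
  using continuous_on_subset[OF assms] by (intro continuous_imp_integrable_real) auto

lemma finite_measure_torus: "finite_measure torus_measure"
  by (intro finite_measure_lebesgue_on) auto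

lemma measure_torus: "measure torus_measure (space torus_measure) = 2 * pi"
  by (simp add: measure_restrict_space)

lemma integrable_bounded_mult_torus:
  fixes f g :: "real \<Rightarrow> complex"
  assumes f: "integrable torus_measure f" and g [measurable]: "g \<in> borel_measurable torus_measure"
    and bound: "\<And>x. x \<in> {0..2 * pi} \<Longrightarrow> norm (g x) \<le> B"
  shows "integrable torus_measure (\<lambda>x. f x * g x)"
proof -
  have [measurable]: "f \<in> borel_measurable torus_measure" using f by auto
  show ?thesis
  proof (rule Bochner_Integration.integrable_bound[of _ "\<lambda>x. B * norm (f x)"])
    show "AE x in torus_measure. norm (f x * g x) \<le> norm (B * norm (f x))"
    proof (rule AE_I2)
      fix x assume "x \<in> space torus_measure"
      then have "norm (g x) \<le> \<bar>B\<bar>" using bound[of x] by simp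
      then show "norm (f x * g x) \<le> norm (B * norm (f x))"
        by (simp add: norm_mult abs_mult mult.commute[of "\<bar>B\<bar>"] mult_left_mono)
    qed
  qed (use f in auto)
qed

lemma integrable_mult_trig:
  "integrable torus_measure f \<Longrightarrow> integrable torus_measure (\<lambda>x. f x * trig k x)"
  by (rule integrable_bounded_mult_torus[where B = 1]) auto

lemma L2_torus_integrable:
  assumes "f \<in> L2_torus"
  shows "integrable torus_measure f"
proof -
  interpret finite_measure torus_measure by (rule finite_measure_torus)
  have [measurable]: "f \<in> borel_measurable torus_measure"
    and sq: "integrable torus_measure (\<lambda>x. (cmod (f x))\<^sup>2)"
    using assms by (auto simp: L2_torus_def)
  show ?thesis
  proof (rule Bochner_Integration.integrable_bound[of _ "\<lambda>x. 1 + (cmod (f x))\<^sup>2"])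
    have "cmod z \<le> 1 + (cmod z)\<^sup>2" for z
    proof -
      have "0 \<le> (cmod z - 1)\<^sup>2" by simp
      also have "\<dots> = (cmod z)\<^sup>2 - 2 * cmod z + 1" by (simp add: power2_diff)
      finally show ?thesis using norm_ge_zero[of z] by linarith
    qed
    then show "AE x in torus_measure. norm (f x) \<le> norm (1 + (cmod (f x))\<^sup>2)"
      by (intro AE_I2) (auto simp: abs_of_nonneg)
  qed (use sq in auto)
qed

lemma C_torus_subset_L2: "C_torus \<subseteq> L2_torus"
proof
  fix u assume u: "u \<in> C_torus"
  then have c: "continuous_on UNIV u" by (simp add: C_torus_def)
  have "integrable torus_measure u" "integrable torus_measure (\<lambda>x. (cmod (u x))\<^sup>2)"
    by (auto intro!: integrable_continuous_torus continuous_intros c)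
  then show "u \<in> L2_torus" using u by (auto simp: C_torus_def L2_torus_def)
qed

lemma trig_poly_C_torus: "trig_poly K c \<in> C_torus"
  by (simp add: C_torus_def periodic_trig_poly continuous_on_trig_poly)

lemma integral_trig: "integral\<^sup>L torus_measure (trig k) = (if k = 0 then of_real (2 * pi) else 0)"
proof -
  have eq: "integral\<^sup>L torus_measure (trig k) = integral {0..2 * pi} (trig k)"
    by (intro lebesgue_integral_eq_integral integrable_continuous_torus continuous_intros) auto
  show ?thesis
  proof (cases "k = 0")
    case False
    have "(trig k has_integral (trig k (2 * pi) / (\<i> * of_int k) - trig k 0 / (\<i> * of_int k))) {0..2 * pi}"
    proof (rule fundamental_theorem_of_calculus)
      fix x
      show "((\<lambda>x. trig k x / (\<i> * of_int k)) has_vector_derivative trig k x) (at x within {0..2 * pi})"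
        using False unfolding cis_conv_exp
        by (auto intro!: derivative_eq_intros has_vector_derivative_real_field
            simp: mult.commute[of "exp _" "\<i>"])
    qed auto
    then show ?thesis using False trig_add_2pi[of k 0] by (simp add: eq integral_unique)
  next
    case True
    then show ?thesis unfolding eq by (simp add: scaleR_conv_of_real)
  qed
qed

lemma fourier_coeff_diff:
  assumes "integrable torus_measure f" "integrable torus_measure g"
  shows "fourier_coeff (\<lambda>x. f x - g x) k = fourier_coeff f k - fourier_coeff g k"
  using integrable_mult_trig[OF assms(1), of "- k"] integrable_mult_trig[OF assms(2), of "- k"]
  by (simp add: fourier_coeff_def left_diff_distrib diff_divide_distrib)

lemma fourier_coeff_trig_poly:
  assumes "finite K"
  shows "fourier_coeff (trig_poly K c) k = (if k \<in> K then c k else 0)"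
proof -
  have "integral\<^sup>L torus_measure (\<lambda>x. trig_poly K c x * cis (- (of_int k * x)))
      = integral\<^sup>L torus_measure (\<lambda>x. \<Sum>j\<in>K. c j * trig (j - k) x)"
    by (simp add: trig_poly_def sum_distrib_right mult.assoc cis_mult left_diff_distrib)
  also have "\<dots> = (\<Sum>j\<in>K. c j * integral\<^sup>L torus_measure (trig (j - k)))"
    by (subst Bochner_Integration.integral_sum)
      (auto intro!: integrable_continuous_torus continuous_intros)
  also have "\<dots> = (\<Sum>j\<in>K. if j = k then c k * of_real (2 * pi) else 0)"
    unfolding integral_trig by (intro sum.cong) auto
  also have "\<dots> = (if k \<in> K then c k else 0) * of_real (2 * pi)"
    using assms by simp
  finally show ?thesis by (simp add: fourier_coeff_def)
qed

lemma integral_mult_cnj_trig_poly: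
  assumes f: "integrable torus_measure f" and K: "finite K"
  shows "integrable torus_measure (\<lambda>x. f x * cnj (trig_poly K c x))"
    and "integral\<^sup>L torus_measure (\<lambda>x. f x * cnj (trig_poly K c x))
      = of_real (2 * pi) * (\<Sum>k\<in>K. cnj (c k) * fourier_coeff f k)"
proof -
  have eq: "f x * cnj (trig_poly K c x) = (\<Sum>k\<in>K. cnj (c k) * (f x * trig (- k) x))" for x
    by (simp add: trig_poly_def sum_distrib_left cis_cnj mult.left_commute)
  have i: "integrable torus_measure (\<lambda>x. cnj (c k) * (f x * trig (- k) x))" for k
    using integrable_mult_trig[OF f] by (intro integrable_mult_right)
  show "integrable torus_measure (\<lambda>x. f x * cnj (trig_poly K c x))"
    unfolding eq using i by (intro Bochner_Integration.integrable_sum)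
  have "integral\<^sup>L torus_measure (\<lambda>x. f x * cnj (trig_poly K c x))
      = (\<Sum>k\<in>K. cnj (c k) * integral\<^sup>L torus_measure (\<lambda>x. f x * trig (- k) x))"
    unfolding eq using i by (subst Bochner_Integration.integral_sum) auto
  then show "integral\<^sup>L torus_measure (\<lambda>x. f x * cnj (trig_poly K c x))
      = of_real (2 * pi) * (\<Sum>k\<in>K. cnj (c k) * fourier_coeff f k)"
    by (simp add: fourier_coeff_def sum_distrib_left)
qed

lemma L2_norm_torus_sq: "(L2_norm_torus f)\<^sup>2 = integral\<^sup>L torus_measure (\<lambda>x. (cmod (f x))\<^sup>2)"
  by (simp add: L2_norm_torus_def)

lemma cnj_mult_self: "cnj z * z = of_real ((cmod z)\<^sup>2)"
  by (metis complex_norm_square mult.commute)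

lemma L2_norm_trig_poly:
  assumes "finite K"
  shows "(L2_norm_torus (trig_poly K c))\<^sup>2 = 2 * pi * (\<Sum>k\<in>K. (cmod (c k))\<^sup>2)"
proof -
  have i: "integrable torus_measure (trig_poly K c)"
    by (intro integrable_continuous_torus continuous_intros)
  have "of_real ((L2_norm_torus (trig_poly K c))\<^sup>2)
      = integral\<^sup>L torus_measure (\<lambda>x. complex_of_real ((cmod (trig_poly K c x))\<^sup>2))"
    unfolding L2_norm_torus_sq by (rule integral_complex_of_real[symmetric])
  also have "\<dots> = of_real (2 * pi * (\<Sum>k\<in>K. (cmod (c k))\<^sup>2))"
    unfolding complex_norm_square integral_mult_cnj_trig_poly(2)[OF i assms]
    using assms by (simp add: fourier_coeff_trig_poly cnj_mult_self)
  finally show ?thesis by (simp only: of_real_eq_iff)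
qed

text \<open>
  Expand the square of the distance from \<open>f\<close> to its Fourier partial sum.
\<close>

lemma Bessel_inequality:
  assumes f: "f \<in> L2_torus" and K: "finite K"
  shows "2 * pi * (\<Sum>k\<in>K. (cmod (fourier_coeff f k))\<^sup>2) \<le> (L2_norm_torus f)\<^sup>2"
proof -
  define p where "p = trig_poly K (fourier_coeff f)"
  define S where "S = 2 * pi * (\<Sum>k\<in>K. (cmod (fourier_coeff f k))\<^sup>2)"
  have i: "integrable torus_measure (\<lambda>x. f x * cnj (p x))"
    and eq: "integral\<^sup>L torus_measure (\<lambda>x. f x * cnj (p x)) = of_real S"
    using integral_mult_cnj_trig_poly[OF L2_torus_integrable[OF f] K, of "fourier_coeff f"]
    by (auto simp: p_def S_def cnj_mult_self)
  have f2: "integrable torus_measure (\<lambda>x. (cmod (f x))\<^sup>2)" using f by (simp add: L2_torus_def)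
  have p2: "integrable torus_measure (\<lambda>x. (cmod (p x))\<^sup>2)"
    unfolding p_def by (intro integrable_continuous_torus continuous_intros)
  have "0 \<le> integral\<^sup>L torus_measure (\<lambda>x. (cmod (f x - p x))\<^sup>2)" by simp
  also have "(\<lambda>x. (cmod (f x - p x))\<^sup>2)
      = (\<lambda>x. (cmod (f x))\<^sup>2 - 2 * Re (f x * cnj (p x)) + (cmod (p x))\<^sup>2)"
    by (rule ext) (simp only: cmod_power2, simp add: power2_eq_square algebra_simps)
  also have "integral\<^sup>L torus_measure \<dots> = (L2_norm_torus f)\<^sup>2
      - 2 * Re (integral\<^sup>L torus_measure (\<lambda>x. f x * cnj (p x))) + (L2_norm_torus p)\<^sup>2"
    using i f2 p2 by (simp add: L2_norm_torus_sq del: times_complex.simps)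
  also have "\<dots> = (L2_norm_torus f)\<^sup>2 - S"
    unfolding eq by (simp add: p_def L2_norm_trig_poly K S_def)
  finally show ?thesis by (simp add: S_def)
qed

section \<open>Uniqueness of Fourier coefficients\<close>

definition trig_orthogonal :: "(real \<Rightarrow> complex) \<Rightarrow> bool" where
  "trig_orthogonal f \<longleftrightarrow> integrable torus_measure f \<and> (\<forall>k. fourier_coeff f k = 0)"

lemma trig_orthogonal_iff:
  "trig_orthogonal f \<longleftrightarrow>
    integrable torus_measure f \<and> (\<forall>k. integral\<^sup>L torus_measure (\<lambda>x. f x * trig k x) = 0)"
proof -
  have "(\<forall>k. fourier_coeff f k = 0) \<longleftrightarrow> (\<forall>k. integral\<^sup>L torus_measure (\<lambda>x. f x * trig (- k) x) = 0)"
    by (simp add: fourier_coeff_def)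
  also have "\<dots> \<longleftrightarrow> (\<forall>k. integral\<^sup>L torus_measure (\<lambda>x. f x * trig k x) = 0)"
    by (metis add.inverse_inverse)
  finally show ?thesis by (simp add: trig_orthogonal_def)
qed

lemma trig_orthogonal_add:
  assumes f: "trig_orthogonal f" and g: "trig_orthogonal g"
  shows "trig_orthogonal (\<lambda>x. f x + g x)"
proof -
  have i: "integrable torus_measure f" "integrable torus_measure g"
    and z: "integral\<^sup>L torus_measure (\<lambda>x. f x * trig k x) = 0"
      "integral\<^sup>L torus_measure (\<lambda>x. g x * trig k x) = 0" for k
    using f g by (auto simp: trig_orthogonal_iff)
  have "integral\<^sup>L torus_measure (\<lambda>x. (f x + g x) * trig k x) = 0" for k
    unfolding distrib_right
    by (subst Bochner_Integration.integral_add[OF integrable_mult_trig[OF i(1)] integrable_mult_trig[OF i(2)]])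
      (simp only: z add_0)
  then show ?thesis using i unfolding trig_orthogonal_iff by (intro conjI allI Bochner_Integration.integrable_add)
qed

lemma trig_orthogonal_cmult:
  assumes "trig_orthogonal f"
  shows "trig_orthogonal (\<lambda>x. c * f x)"
proof -
  have "integral\<^sup>L torus_measure (\<lambda>x. c * f x * trig k x) = 0" for k
    using assms unfolding trig_orthogonal_iff mult.assoc integral_mult_right_zero by simp
  then show ?thesis using assms unfolding trig_orthogonal_iff by (intro conjI allI integrable_mult_right) auto
qed

lemma trig_orthogonal_mult_trig: "trig_orthogonal f \<Longrightarrow> trig_orthogonal (\<lambda>x. f x * trig j x)"
proof -
  assume f: "trig_orthogonal f"
  have eq: "(\<lambda>x. f x * trig j x * trig k x) = (\<lambda>x. f x * trig (j + k) x)" for k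
    by (rule ext) (simp add: mult.assoc cis_mult distrib_right)
  show ?thesis using f integrable_mult_trig[of f j] unfolding trig_orthogonal_iff eq by blast
qed

text \<open>
  Being orthogonal to all exponentials is inherited by products with exponentials, hence with
  \<open>cos\<close> and \<open>sin\<close>, hence with every polynomial on the circle. Keeping \<open>f\<close> arbitrary
  in the induction makes the product case a double application of the induction hypothesis.
\<close>

lemma trig_orthogonal_mult_polynomial:
  fixes p :: "complex \<Rightarrow> real"
  assumes "real_polynomial_function p" and "trig_orthogonal f"
  shows "trig_orthogonal (\<lambda>x. f x * of_real (p (cis x)))"
  using assms
proof (induction p arbitrary: f rule: real_polynomial_function.induct)
  case (linear h)
  note f = \<open>trig_orthogonal f\<close>
  from linear(1) interpret bounded_linear h .
  have h: "h (cis x) = cos x * h 1 + sin x * h \<i>" for x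
  proof -
    have "cis x = cos x *\<^sub>R 1 + sin x *\<^sub>R \<i>" by (simp add: complex_eq_iff)
    then show ?thesis by (simp add: add scaleR)
  qed
  have "complex_of_real (h (cis x))
      = (of_real (h 1) - \<i> * of_real (h \<i>)) / 2 * trig 1 x
        + (of_real (h 1) + \<i> * of_real (h \<i>)) / 2 * trig (- 1) x" for x
    by (simp add: h complex_eq_iff diff_divide_distrib add_divide_distrib)
  then have eq: "f x * complex_of_real (h (cis x))
      = (of_real (h 1) - \<i> * of_real (h \<i>)) / 2 * (f x * trig 1 x)
        + (of_real (h 1) + \<i> * of_real (h \<i>)) / 2 * (f x * trig (- 1) x)" for x
    by (simp only: distrib_left mult.left_commute)
  show ?case unfolding eq
    by (intro trig_orthogonal_add trig_orthogonal_cmult trig_orthogonal_mult_trig f)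
next
  case (const c)
  then show ?case using trig_orthogonal_cmult[of f "of_real c"] by (simp add: mult.commute)
next
  case (add p q)
  then show ?case unfolding of_real_add distrib_left by (intro trig_orthogonal_add)
next
  case (mult p q)
  have "trig_orthogonal (\<lambda>x. f x * of_real (p (cis x)) * of_real (q (cis x)))"
    by (intro mult.IH mult.prems)
  then show ?case by (simp only: of_real_mult mult.assoc)
qed

lemma continuous_on_of_real_cis:
  "continuous_on UNIV q \<Longrightarrow> continuous_on UNIV (\<lambda>x::real. complex_of_real (q (cis x)))"
  by (rule continuous_on_of_real, rule continuous_on_compose2[where f = cis and g = q])
    (auto intro!: continuous_intros)

text \<open>
  By the Stone-Weierstrass theorem a continuous function on the unit circle is a uniform limit of
  polynomials.
\<close>

lemma trig_orthogonal_integral_continuous: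
  fixes \<psi> :: "complex \<Rightarrow> real"
  assumes f: "trig_orthogonal f" and \<psi>: "continuous_on UNIV \<psi>"
  shows "integral\<^sup>L torus_measure (\<lambda>x. f x * of_real (\<psi> (cis x))) = 0"
proof -
  let ?I = "integral\<^sup>L torus_measure (\<lambda>x. f x * of_real (\<psi> (cis x)))"
  have i: "integrable torus_measure f" using f by (simp add: trig_orthogonal_def)
  define B where "B = integral\<^sup>L torus_measure (\<lambda>x. cmod (f x))"
  have B: "B \<ge> 0" by (simp add: B_def)
  have "cmod ?I \<le> e" if e: "e > 0" for e
  proof -
    have "e / (B + 1) > 0" using e B by simp
    then obtain p where p: "real_polynomial_function p"
      and close: "\<And>z. z \<in> sphere 0 1 \<Longrightarrow> \<bar>\<psi> z - p z\<bar> < e / (B + 1)"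
      using Stone_Weierstrass_real_polynomial_function[of "sphere 0 1" \<psi> "e / (B + 1)"]
        continuous_on_subset[OF \<psi>] by auto
    define d where "d z = \<psi> z - p z" for z
    have p_cont: "continuous_on UNIV p"
      using p by (simp add: continuous_on_polymonial_function real_polynomial_function_eq)
    then have d_cont: "continuous_on UNIV d" unfolding d_def by (intro continuous_intros \<psi>)
    have dm: "(\<lambda>x. complex_of_real (d (cis x))) \<in> borel_measurable torus_measure"
      by (intro borel_measurable_integrable integrable_continuous_torus continuous_on_of_real_cis d_cont)
    have bd: "cmod (of_real (d (cis x))) \<le> e / (B + 1)" for x
      using close[of "cis x"] unfolding norm_of_real d_def by simp
    have int_d: "integrable torus_measure (\<lambda>x. f x * of_real (d (cis x)))"
      by (rule integrable_bounded_mult_torus[OF i dm bd])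
    have pf: "trig_orthogonal (\<lambda>x. f x * of_real (p (cis x)))"
      by (rule trig_orthogonal_mult_polynomial[OF p f])
    then have int_p: "integrable torus_measure (\<lambda>x. f x * of_real (p (cis x)))"
      and zero: "integral\<^sup>L torus_measure (\<lambda>x. f x * of_real (p (cis x))) = 0"
      unfolding trig_orthogonal_iff by (auto dest: spec[of _ 0])
    have "?I = integral\<^sup>L torus_measure (\<lambda>x. f x * of_real (d (cis x)) + f x * of_real (p (cis x)))"
      by (simp add: d_def flip: distrib_left of_real_add)
    also have "\<dots> = integral\<^sup>L torus_measure (\<lambda>x. f x * of_real (d (cis x)))"
      using int_d int_p zero by simp
    finally have "cmod ?I \<le> integral\<^sup>L torus_measure (\<lambda>x. cmod (f x * of_real (d (cis x))))"
      by simp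
    also have "\<dots> \<le> integral\<^sup>L torus_measure (\<lambda>x. cmod (f x) * (e / (B + 1)))"
    proof (rule integral_mono)
      fix x show "cmod (f x * of_real (d (cis x))) \<le> cmod (f x) * (e / (B + 1))"
        using bd[of x] unfolding norm_mult by (intro mult_left_mono) auto
    qed (use int_d i in \<open>auto intro!: integrable_mult_left\<close>)
    also have "\<dots> = B * (e / (B + 1))" by (simp add: B_def)
    also have "\<dots> \<le> e" using B e by (simp add: field_simps)
    finally show ?thesis .
  qed
  then have "cmod ?I \<le> 0" by (rule field_le_epsilon[of _ 0, simplified])
  then show ?thesis by simp
qed

text \<open>
  The indicator of the compact arc set \<open>cis ` T\<close> is the bounded pointwise limit of continuous functions
  of the distance to it. Staying away from the endpoints \<open>0\<close> and \<open>2 * pi\<close>, which \<open>cis\<close> identifies,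
  makes membership in the arc set the same as membership in \<open>T\<close>.
\<close>

lemma trig_orthogonal_set_integral_compact:
  assumes f: "trig_orthogonal f" and T: "compact T" "T \<subseteq> {0<..<2 * pi}"
  shows "integral\<^sup>L torus_measure (\<lambda>x. f x * indicator T x) = 0"
proof (cases "T = {}")
  case False
  have i: "integrable torus_measure f" using f by (simp add: trig_orthogonal_def)
  define C where "C = cis ` T"
  have C: "closed C" "C \<noteq> {}"
    using T False unfolding C_def
    by (auto intro!: compact_imp_closed compact_continuous_image continuous_intros)
  have mem: "cis x \<in> C \<longleftrightarrow> x \<in> T" if x: "x \<in> {0..2 * pi}" for x
  proof
    assume "cis x \<in> C"
    then obtain y where y: "y \<in> T" "cis x = cis y" by (auto simp: C_def)
    have close: "\<bar>x - y\<bar> < 2 * pi" using T y x by (auto simp: subset_iff)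
    have "cis (x - y) = 1" using y(2) by (simp flip: cis_divide)
    then have "cos (x - y) = 1" by (simp add: complex_eq_iff)
    then obtain k :: int where k: "x - y = of_int k * 2 * pi"
      using cos_one_2pi_int by blast
    have "\<bar>real_of_int k\<bar> < 1"
      using close unfolding k by (simp add: abs_mult)
    then have "k = 0" by linarith
    then show "x \<in> T" using k y by simp
  qed (auto simp: C_def)
  define \<psi> where "\<psi> n z = max 0 (1 - real n * infdist z C)" for n z
  have \<psi>01: "0 \<le> \<psi> n z" "\<psi> n z \<le> 1" for n z by (auto simp: \<psi>_def infdist_nonneg)
  have \<psi>_cont: "continuous_on UNIV (\<psi> n)" for n
    unfolding \<psi>_def by (intro continuous_intros)
  have \<psi>_lim: "(\<lambda>n. \<psi> n z) \<longlonglongrightarrow> indicator C z" for z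
  proof (cases "z \<in> C")
    case False
    then have pos: "infdist z C > 0" using C by (metis in_closed_iff_infdist_zero infdist_nonneg less_eq_real_def)
    have "eventually (\<lambda>n. \<psi> n z = 0) sequentially"
    proof -
      obtain N where N: "1 < real N * infdist z C" using reals_Archimedean3[OF pos] by blast
      have "\<psi> n z = 0" if "n \<ge> N" for n
      proof -
        have "real N * infdist z C \<le> real n * infdist z C" using that pos by (intro mult_right_mono) auto
        then show ?thesis using N by (simp add: \<psi>_def)
      qed
      then show ?thesis by (auto simp: eventually_sequentially)
    qed
    then show ?thesis using False by (simp add: tendsto_eventually)
  qed (use C in \<open>simp add: \<psi>_def in_closed_iff_infdist_zero[THEN iffD1]\<close>)
  have fm[measurable]: "f \<in> borel_measurable torus_measure" using i by auto
  have \<psi>m[measurable]: "(\<lambda>x. complex_of_real (\<psi> n (cis x))) \<in> borel_measurable torus_measure" for n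
    by (intro borel_measurable_integrable integrable_continuous_torus continuous_on_of_real_cis \<psi>_cont)
  have Tm: "T \<in> sets lebesgue" using T by (simp add: lmeasurable_compact fmeasurableD)
  then have [measurable]: "T \<inter> {0..2*pi} \<in> sets torus_measure" by (auto simp: sets_restrict_space)
  have "(\<lambda>n. integral\<^sup>L torus_measure (\<lambda>x. f x * of_real (\<psi> n (cis x))))
      \<longlonglongrightarrow> integral\<^sup>L torus_measure (\<lambda>x. f x * indicator (T \<inter> {0..2*pi}) x)"
  proof (rule integral_dominated_convergence[where w = "\<lambda>x. cmod (f x)"])
    show "AE x in torus_measure. (\<lambda>n. f x * of_real (\<psi> n (cis x))) \<longlonglongrightarrow> f x * indicator (T \<inter> {0..2*pi}) x"
    proof (rule AE_I2)
      fix x assume "x \<in> space torus_measure"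
      then have x: "x \<in> {0..2 * pi}" by simp
      have "(\<lambda>n. complex_of_real (\<psi> n (cis x))) \<longlonglongrightarrow> of_real (indicator C (cis x))"
        by (intro tendsto_of_real \<psi>_lim)
      also have "complex_of_real (indicator C (cis x)) = indicator (T \<inter> {0..2*pi}) x"
        using mem[OF x] x by (simp add: indicator_def)
      finally show "(\<lambda>n. f x * of_real (\<psi> n (cis x))) \<longlonglongrightarrow> f x * indicator (T \<inter> {0..2*pi}) x"
        by (intro tendsto_intros)
    qed
    show "AE x in torus_measure. norm (f x * of_real (\<psi> n (cis x))) \<le> cmod (f x)" for n
      using \<psi>01 by (intro AE_I2) (auto simp: norm_mult intro!: mult_left_le)
  qed (use i in auto)
  then have "integral\<^sup>L torus_measure (\<lambda>x. f x * indicator (T \<inter> {0..2*pi}) x) = 0"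
    using trig_orthogonal_integral_continuous[OF f \<psi>_cont] by (simp add: LIMSEQ_const_iff)
  moreover have "T \<inter> {0..2*pi} = T" using T(2) by auto
  ultimately show ?thesis by simp
qed auto

text \<open>
  Inside the set where \<open>g\<close> is positive, inner regularity supplies compact sets missing arbitrarily little measure;
  the integral of \<open>g\<close> over each of them vanishes, so each of them is a null set.
\<close>

lemma AE_nonpos_of_compact_integrals_zero:
  fixes g :: "real \<Rightarrow> real"
  assumes g: "integrable torus_measure g"
    and zero: "\<And>T. compact T \<Longrightarrow> T \<subseteq> {0<..<2 * pi} \<Longrightarrow> integral\<^sup>L torus_measure (\<lambda>x. g x * indicator T x) = 0"
  shows "AE x in torus_measure. g x \<le> 0"
proof -
  have [measurable]: "g \<in> borel_measurable torus_measure" using g by auto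
  define A where "A = {x \<in> {0<..<2 * pi}. g x > 0}"
  have "{x \<in> space torus_measure. g x > 0} \<in> sets torus_measure" by measurable
  then have "{x \<in> {0..2 * pi}. g x > 0} \<in> sets lebesgue"
    by (auto simp: sets_restrict_space space_restrict_space intro!: sets.Int)
  moreover have "A = {x \<in> {0..2 * pi}. g x > 0} \<inter> {0<..<2 * pi}" by (auto simp: A_def)
  ultimately have A: "A \<in> sets lebesgue" by auto
  have "emeasure lebesgue A \<le> 0 + ennreal e" if e: "e > 0" for e
  proof -
    obtain T where T: "closed T" "T \<subseteq> A" "A - T \<in> lmeasurable" "emeasure lebesgue (A - T) < ennreal e"
      using sets_lebesgue_inner_closed[OF A e] by blast
    have sub: "T \<subseteq> {0<..<2 * pi}" using T(2) by (auto simp: A_def)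
    have "bounded T" using sub by (rule bounded_subset[rotated]) simp
    then have cT: "compact T" using T(1) by (simp add: compact_eq_bounded_closed)
    have Tm: "T \<in> sets lebesgue" using cT by (simp add: lmeasurable_compact fmeasurableD)
    have "T \<inter> {0..2 * pi} \<in> sets torus_measure" using Tm by (auto simp: sets_restrict_space)
    moreover have "T \<inter> {0..2 * pi} = T" using sub by auto
    ultimately have [measurable]: "T \<in> sets torus_measure" by simp
    have "integrable torus_measure (\<lambda>x. g x * indicator T x)"
      using integrable_real_mult_indicator[OF _ g, of T] by simp
    moreover have "AE x in torus_measure. 0 \<le> g x * indicator T x"
      using T(2) by (intro AE_I2) (auto simp: A_def indicator_def)
    ultimately have "AE x in torus_measure. g x * indicator T x = 0"
      using zero[OF cT sub] integral_nonneg_eq_0_iff_AE by blast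
    then have "AE x in torus_measure. x \<notin> T"
      by (rule AE_mp) (use T(2) in \<open>auto simp: A_def intro!: AE_I2\<close>)
    then have "AE x in lebesgue. x \<in> {0..2 * pi} \<longrightarrow> x \<notin> T"
      by (subst (asm) AE_restrict_space_iff) auto
    then have "AE x in lebesgue. x \<notin> T"
      by (rule AE_mp) (use sub in \<open>auto intro!: AE_I2\<close>)
    then have "T \<in> null_sets lebesgue" using AE_iff_null_sets[OF Tm] by simp
    then have "emeasure lebesgue (T \<union> (A - T)) \<le> 0 + emeasure lebesgue (A - T)"
      using emeasure_subadditive[of T lebesgue "A - T"] Tm A by (simp add: null_setsD1)
    also have "T \<union> (A - T) = A" using T(2) by auto
    finally show ?thesis using T(4) by auto
  qed
  then have "emeasure lebesgue A = 0"
    using ennreal_le_epsilon[of 0 "emeasure lebesgue A"] by auto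
  then have null: "A \<in> null_sets lebesgue" using A by (auto simp: null_sets_def)
  have "{0, 2 * pi} \<in> null_sets lebesgue"
    using negligible_iff_null_sets negligible_finite by blast
  with null have "A \<union> {0, 2 * pi} \<in> null_sets lebesgue" by (rule null_sets.Un)
  then have "AE x in lebesgue. x \<notin> A \<union> {0, 2 * pi}" by (rule AE_not_in)
  then have "AE x in lebesgue. x \<in> {0..2 * pi} \<longrightarrow> g x \<le> 0"
    by (rule AE_mp) (auto simp: A_def intro!: AE_I2)
  then show ?thesis by (subst AE_restrict_space_iff) auto
qed

text \<open>
  The sign criterion, applied to the real parts of \<open>f\<close>, \<open>- f\<close>, \<open>\<i> f\<close> and \<open>- \<i> f\<close>,
  gives completeness of the trigonometric system.
\<close>

lemma trig_orthogonal_AE_zero: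
  assumes f: "trig_orthogonal f"
  shows "AE x in torus_measure. f x = 0"
proof -
  have neg: "AE x in torus_measure. Re (c * f x) \<le> 0" for c
  proof (rule AE_nonpos_of_compact_integrals_zero)
    have cf: "trig_orthogonal (\<lambda>x. c * f x)" by (rule trig_orthogonal_cmult[OF f])
    then have i: "integrable torus_measure (\<lambda>x. c * f x)" by (simp only: trig_orthogonal_def)
    then show "integrable torus_measure (\<lambda>x. Re (c * f x))" by (rule integrable_Re)
    fix T :: "real set" assume T: "compact T" "T \<subseteq> {0<..<2 * pi}"
    have "T \<in> sets lebesgue" using T by (simp add: lmeasurable_compact fmeasurableD)
    then have "T \<inter> {0..2 * pi} \<in> sets torus_measure" by (auto simp: sets_restrict_space)
    moreover have "T \<inter> {0..2 * pi} = T" using T by auto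
    ultimately have Tm: "T \<in> sets torus_measure" by simp
    have iT: "integrable torus_measure (\<lambda>x. c * f x * indicator T x)"
      using integrable_mult_indicator[OF Tm i] by (simp add: scaleR_conv_of_real of_real_indicator mult.commute)
    have "integral\<^sup>L torus_measure (\<lambda>x. Re (c * f x) * indicator T x)
        = integral\<^sup>L torus_measure (\<lambda>x. Re (c * f x * indicator T x))"
      by (intro Bochner_Integration.integral_cong) (auto simp: indicator_def)
    also have "\<dots> = Re (integral\<^sup>L torus_measure (\<lambda>x. c * f x * indicator T x))"
      by (rule integral_Re[OF iT])
    also have "\<dots> = 0"
      by (simp only: trig_orthogonal_set_integral_compact[OF cf T] zero_complex.simps)
    finally show "integral\<^sup>L torus_measure (\<lambda>x. Re (c * f x) * indicator T x) = 0" .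
  qed
  show ?thesis
    using neg[of 1] neg[of "- 1"] neg[of \<i>] neg[of "- \<i>"]
    by eventually_elim (simp add: complex_eq_iff)
qed

text \<open>
  This makes the norm of \<open>frac_laplacian n u\<close> computable although its definition picks an arbitrary
  function with the prescribed coefficients.
\<close>

lemma L2_norm_torus_eqI:
  assumes f: "f \<in> L2_torus" and g: "g \<in> L2_torus" and eq: "\<And>k. fourier_coeff f k = fourier_coeff g k"
  shows "L2_norm_torus f = L2_norm_torus g"
proof -
  have i: "integrable torus_measure f" "integrable torus_measure g"
    using f g L2_torus_integrable by auto
  then have "trig_orthogonal (\<lambda>x. f x - g x)"
    by (simp add: trig_orthogonal_def fourier_coeff_diff eq)
  then have ae: "AE x in torus_measure. f x - g x = 0" by (rule trig_orthogonal_AE_zero)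
  have [measurable]: "f \<in> borel_measurable torus_measure" "g \<in> borel_measurable torus_measure"
    using i by auto
  have "integral\<^sup>L torus_measure (\<lambda>x. (cmod (f x))\<^sup>2) = integral\<^sup>L torus_measure (\<lambda>x. (cmod (g x))\<^sup>2)"
  proof (rule integral_cong_AE)
    show "AE x in torus_measure. (cmod (f x))\<^sup>2 = (cmod (g x))\<^sup>2"
      using ae by eventually_elim simp
  qed auto
  then show ?thesis by (simp add: L2_norm_torus_def)
qed

lemma trig_orthogonal_continuous_zero:
  assumes f: "trig_orthogonal f" and cont: "continuous_on UNIV f" and x: "x \<in> {0..2 * pi}"
  shows "f x = 0"
proof -
  have c2: "continuous_on UNIV (\<lambda>x. (cmod (f x))\<^sup>2)" by (intro continuous_intros cont)
  have i: "integrable torus_measure (\<lambda>x. (cmod (f x))\<^sup>2)" by (rule integrable_continuous_torus[OF c2])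
  have "integral\<^sup>L torus_measure (\<lambda>x. (cmod (f x))\<^sup>2) = 0"
    using trig_orthogonal_AE_zero[OF f] by (intro integral_eq_zero_AE) (auto elim: AE_mp)
  then have "integral {0..2 * pi} (\<lambda>x. (cmod (f x))\<^sup>2) = 0"
    using lebesgue_integral_eq_integral[OF i] by simp
  moreover have "(\<lambda>x. (cmod (f x))\<^sup>2) integrable_on {0..2 * pi}"
    using continuous_on_subset[OF c2] by (intro integrable_continuous_interval) auto
  ultimately have "((\<lambda>x. (cmod (f x))\<^sup>2) has_integral 0) (cbox 0 (2 * pi))"
    by (metis cbox_interval integrable_integral)
  then have "(cmod (f x))\<^sup>2 = 0"
    using x continuous_on_subset[OF c2]
    by (intro has_integral_0_cbox_imp_0[of 0 "2 * pi" "\<lambda>x. (cmod (f x))\<^sup>2"]) (auto simp: not_le)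
  then show ?thesis by simp
qed

lemma norm_fourier_coeff_le:
  assumes g: "integrable torus_measure g" and B: "\<And>x. cmod (g x) \<le> B"
  shows "cmod (fourier_coeff g k) \<le> B"
proof -
  interpret finite_measure torus_measure by (rule finite_measure_torus)
  have "cmod (integral\<^sup>L torus_measure (\<lambda>x. g x * trig (- k) x))
      \<le> integral\<^sup>L torus_measure (\<lambda>x. cmod (g x * trig (- k) x))" by simp
  also have "\<dots> \<le> integral\<^sup>L torus_measure (\<lambda>_. B)"
    using integrable_mult_trig[OF g, of "- k"] integrable_norm[OF g] B by (intro integral_mono) (auto simp: norm_mult)
  also have "\<dots> = 2 * pi * B" using measure_torus by simp
  finally show ?thesis by (simp add: fourier_coeff_def norm_divide field_simps)
qed

text \<open>
  Bounded partial sums of the moduli make the coefficients absolutely summable, which makes the Fourier series converge uniformly to a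
  continuous function; that function has the coefficients of \<open>u\<close>, hence equals \<open>u\<close>.
\<close>

lemma cmod_le_sum_fourier_coeff:
  assumes u: "u \<in> C_torus"
    and S: "\<And>N :: nat. (\<Sum>k\<in>{- int N..int N}. cmod (fourier_coeff u k)) \<le> S"
  shows "cmod (u x) \<le> S"
proof -
  have uc: "continuous_on UNIV u" and up: "\<And>x. u (x + 2 * pi) = u x"
    using u by (auto simp: C_torus_def periodic_2pi_def)
  have ui: "integrable torus_measure u" by (rule integrable_continuous_torus[OF uc])
  define c where "c = fourier_coeff u"
  define I where "I N = {- int N..int N}" for N
  define s where "s N = trig_poly (I N) c" for N
  define a where "a N = (\<Sum>k\<in>I N. cmod (c k))" for N
  have I: "finite (I N)" "M \<le> N \<Longrightarrow> I M \<subseteq> I N" for M N by (auto simp: I_def)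
  have step: "cmod (s N x - s M x) \<le> a N - a M" if "M \<le> N" for M N x
  proof -
    have "s N x - s M x = (\<Sum>k\<in>I N - I M. c k * trig k x)"
      unfolding s_def trig_poly_def using I that by (simp add: sum_diff)
    also have "cmod \<dots> \<le> (\<Sum>k\<in>I N - I M. cmod (c k))"
      by (rule order_trans[OF norm_sum]) (simp add: norm_mult)
    also have "\<dots> = a N - a M" unfolding a_def using I that by (simp add: sum_diff)
    finally show ?thesis .
  qed
  have "incseq a"
  proof (rule monoI)
    fix M N :: nat assume "M \<le> N"
    then show "a M \<le> a N" using step[of M N 0] norm_ge_zero[of "s N 0 - s M 0"] by linarith
  qed
  moreover have "a N \<le> S" for N using S by (simp add: a_def I_def c_def)
  ultimately have "convergent a" by (metis incseq_convergent convergentI)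
  then have Cauchy: "Cauchy a" by (rule convergent_Cauchy)
  have "uniformly_Cauchy_on UNIV s"
    unfolding uniformly_Cauchy_on_def
  proof (intro allI impI)
    fix e :: real assume "e > 0"
    then obtain M where M: "\<And>m n. m \<ge> M \<Longrightarrow> n \<ge> M \<Longrightarrow> dist (a m) (a n) < e"
      using Cauchy unfolding Cauchy_def by blast
    have "dist (s m x) (s n x) < e" if "m \<ge> M" "n \<ge> M" for m n x
    proof (cases "m \<le> n")
      case True
      then show ?thesis using step[of m n x] M[OF that] by (auto simp: dist_norm norm_minus_commute)
    next
      case False
      then show ?thesis using step[of n m x] M[OF that] by (auto simp: dist_norm)
    qed
    then show "\<exists>M. \<forall>x\<in>UNIV. \<forall>m\<ge>M. \<forall>n\<ge>M. dist (s m x) (s n x) < e" by blast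
  qed
  then have "uniformly_convergent_on UNIV s" by (rule Cauchy_uniformly_convergent)
  then obtain v where v: "uniform_limit UNIV s v sequentially"
    by (auto simp: uniformly_convergent_on_def)
  have vc: "continuous_on UNIV v"
    by (rule uniform_limit_theorem[OF _ v])
      (auto simp: s_def intro!: always_eventually continuous_on_trig_poly)
  have si: "integrable torus_measure (s N)" for N
    unfolding s_def by (intro integrable_continuous_torus continuous_on_trig_poly)
  have vi: "integrable torus_measure v" by (rule integrable_continuous_torus[OF vc])
  \<comment> \<open>From some index on, the coefficient of \<open>u - v\<close> is that of \<open>s N - v\<close>, which is uniformly small.\<close>
  have "fourier_coeff (\<lambda>x. u x - v x) k = 0" for k
  proof -
    have "cmod (fourier_coeff (\<lambda>x. u x - v x) k) \<le> e" if e: "e > 0" for e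
    proof -
      have "eventually (\<lambda>N. \<forall>x. dist (s N x) (v x) < e) sequentially"
        using uniform_limitD[OF v e] by simp
      then obtain M where M: "\<And>N x. N \<ge> M \<Longrightarrow> dist (s N x) (v x) < e"
        unfolding eventually_sequentially by blast
      define N where "N = max M (nat \<bar>k\<bar>)"
      have "k \<in> I N" by (auto simp: I_def N_def)
      then have "fourier_coeff (s N) k = c k"
        unfolding s_def by (simp add: fourier_coeff_trig_poly I)
      then have "fourier_coeff (\<lambda>x. u x - v x) k = fourier_coeff (\<lambda>x. s N x - v x) k"
        by (simp add: fourier_coeff_diff ui vi si c_def)
      also have "cmod \<dots> \<le> e"
        using M[of N] si vi
        by (intro norm_fourier_coeff_le) (auto simp: N_def dist_norm intro: less_imp_le)
      finally show ?thesis .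
    qed
    then have "cmod (fourier_coeff (\<lambda>x. u x - v x) k) \<le> 0" by (rule field_le_epsilon[of _ 0, simplified])
    then show ?thesis by simp
  qed
  then have orth: "trig_orthogonal (\<lambda>x. u x - v x)" using ui vi by (simp add: trig_orthogonal_def)
  have base: "cmod (u x) \<le> S" if x: "x \<in> {0..2 * pi}" for x
  proof -
    have "u x - v x = 0"
      by (rule trig_orthogonal_continuous_zero[OF orth _ x]) (intro continuous_intros uc vc)
    moreover have "(\<lambda>N. s N x) \<longlonglongrightarrow> v x" using tendsto_uniform_limitI[OF v] by simp
    ultimately have "(\<lambda>N. cmod (s N x)) \<longlonglongrightarrow> cmod (u x)" by (simp add: tendsto_norm)
    moreover have "cmod (s N x) \<le> S" for N
    proof -
      have "cmod (s N x) \<le> a N"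
        unfolding s_def trig_poly_def a_def
        by (rule order_trans[OF norm_sum]) (simp add: norm_mult)
      then show ?thesis using \<open>\<And>N. a N \<le> S\<close>[of N] by linarith
    qed
    ultimately show ?thesis by (intro LIMSEQ_le_const2) auto
  qed
  interpret periodic_fun_simple u "2 * pi" by standard (rule up)
  define j where "j = \<lfloor>x / (2 * pi)\<rfloor>"
  have "of_int j \<le> x / (2 * pi)" "x / (2 * pi) < of_int j + 1" by (auto simp: j_def)
  then have "x - of_int j * (2 * pi) \<in> {0..2 * pi}" by (auto simp: field_simps)
  from base[OF this] show ?thesis by (simp only: minus_of_int)
qed

section \<open>The remainder term\<close>

lemma frac_laplacian_props:
  assumes "u \<in> H_torus n"
  shows "frac_laplacian n u \<in> L2_torus"
    and "fourier_coeff (frac_laplacian n u) k = of_int (\<bar>k\<bar> ^ n) * fourier_coeff u k"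
proof -
  have "is_frac_laplacian n u (frac_laplacian n u)"
    using assms someI_ex[of "is_frac_laplacian n u"] by (auto simp: H_torus_def frac_laplacian_def)
  then show "frac_laplacian n u \<in> L2_torus"
    and "fourier_coeff (frac_laplacian n u) k = of_int (\<bar>k\<bar> ^ n) * fourier_coeff u k"
    by (auto simp: is_frac_laplacian_def)
qed

lemma sum_nonzero_symmetric_int:
  fixes f :: "real \<Rightarrow> real"
  shows "(\<Sum>k\<in>{- int N..int N} - {0}. f \<bar>real_of_int k\<bar>) = 2 * (\<Sum>k<N. f (real (Suc k)))"
proof (induction N)
  case (Suc N)
  define J where "J = {- int N..int N} - {0}"
  define p where "p = int (Suc N)"
  have p: "finite J" "p \<notin> insert (- p) J" "- p \<notin> J" "\<bar>real_of_int p\<bar> = real (Suc N)"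
    by (auto simp: J_def p_def)
  have "{- int (Suc N)..int (Suc N)} - {0} = insert p (insert (- p) J)"
    by (auto simp: J_def p_def)
  then have "(\<Sum>k\<in>{- int (Suc N)..int (Suc N)} - {0}. f \<bar>real_of_int k\<bar>)
      = f (real (Suc N)) + (f (real (Suc N)) + (\<Sum>k\<in>J. f \<bar>real_of_int k\<bar>))"
    using p by (simp del: of_nat_Suc)
  then show ?case using Suc unfolding J_def by (simp del: of_nat_Suc)
qed simp

text \<open>
  The gap \<open>(1/2)\<^sup>2\<^sup>n / 16\<close> of the Riemann sum, scaled by the factor
  \<open>(\<delta> + \<kappa>) / (pi * \<kappa>)\<close> with \<open>\<kappa> = (2n - 1) \<delta>\<close>.
\<close>

definition remainder_gap :: "nat \<Rightarrow> real" where
  "remainder_gap n = real (2 * n) / ((real (2 * n) - 1) * pi) * ((1 / 2) ^ (2 * n) / 16)"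

text \<open>
  Cauchy-Schwarz with the weight \<open>\<bar>k\<bar>\<^sup>2\<^sup>n + \<kappa>\<close> bounds the sum of the moduli of the coefficients by the
  lattice sum of the inverse weight and the weighted energy. Bessel's inequality for \<open>u\<close> and for
  \<open>(-\<Delta>)\<^sup>n\<^sup>/\<^sup>2 u\<close> bounds the latter.
\<close>

lemma C_norm_bound:
  fixes n :: nat and \<delta> :: real
  assumes n: "n \<ge> 1" and \<delta>: "\<delta> \<ge> 1"
    and u: "u \<in> H_torus n" "u \<in> C_torus" "integral\<^sup>L torus_measure u = 0" "L2_norm_torus u = 1"
    and w: "(L2_norm_torus (frac_laplacian n u))\<^sup>2 = \<delta>"
  shows "(C_norm_torus u)\<^sup>2 \<le> c1 n * \<delta> powr (1 / (2 * real n)) - remainder_gap n"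
proof -
  define X where "X = c1 n * \<delta> powr (1 / (2 * real n)) - remainder_gap n"
  define \<kappa> where "\<kappa> = (real (2 * n) - 1) * \<delta>"
  have \<kappa>: "\<kappa> > 0" using n \<delta> by (simp add: \<kappa>_def)
  define c where "c k = cmod (fourier_coeff u k)" for k
  have c0: "c 0 = 0" using u(3) by (simp add: c_def fourier_coeff_def)
  define wt where "wt t = t ^ (2 * n) + \<kappa>" for t :: real
  have wt: "wt \<bar>t\<bar> > 0" for t using \<kappa> by (simp add: wt_def add_nonneg_pos)
  have sum_sq: "(\<Sum>k\<in>{- int N..int N}. c k)\<^sup>2 \<le> X" for N
  proof -
    define J where "J = {- int N..int N} - {0}"
    have J: "finite J" by (simp add: J_def)
    have bessel_u: "2 * pi * (\<Sum>k\<in>J. (c k)\<^sup>2) \<le> 1"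
      using Bessel_inequality[of u J] C_torus_subset_L2 u J by (auto simp: c_def)
    have "2 * pi * (\<Sum>k\<in>J. (cmod (fourier_coeff (frac_laplacian n u) k))\<^sup>2) \<le> \<delta>"
      using Bessel_inequality[OF frac_laplacian_props(1)[OF u(1)] J] w by simp
    moreover have "(cmod (fourier_coeff (frac_laplacian n u) k))\<^sup>2 = \<bar>real_of_int k\<bar> ^ (2 * n) * (c k)\<^sup>2" for k
      unfolding frac_laplacian_props(2)[OF u(1)] c_def
      by (simp add: norm_mult norm_power power_mult_distrib power_mult mult.commute[of 2 n])
    ultimately have bessel_w: "2 * pi * (\<Sum>k\<in>J. \<bar>real_of_int k\<bar> ^ (2 * n) * (c k)\<^sup>2) \<le> \<delta>" by simp
    have energy: "(\<Sum>k\<in>J. wt \<bar>real_of_int k\<bar> * (c k)\<^sup>2) \<le> (\<delta> + \<kappa>) / (2 * pi)"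
    proof -
      have "2 * pi * (\<Sum>k\<in>J. wt \<bar>real_of_int k\<bar> * (c k)\<^sup>2)
          = 2 * pi * (\<Sum>k\<in>J. \<bar>real_of_int k\<bar> ^ (2 * n) * (c k)\<^sup>2) + \<kappa> * (2 * pi * (\<Sum>k\<in>J. (c k)\<^sup>2))"
        by (simp add: wt_def distrib_right sum.distrib sum_distrib_left mult_ac distrib_left)
      also have "\<dots> \<le> \<delta> + \<kappa> * 1"
        using \<kappa> by (intro add_mono bessel_w mult_left_mono bessel_u) auto
      finally show ?thesis by (simp add: field_simps)
    qed
    have "(\<Sum>k\<in>{- int N..int N}. c k) = (\<Sum>k\<in>J. c k)"
      unfolding J_def using c0 by (intro sum.mono_neutral_right) auto
    also have "\<dots> = (\<Sum>k\<in>J. 1 / sqrt (wt \<bar>real_of_int k\<bar>) * (sqrt (wt \<bar>real_of_int k\<bar>) * c k))"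
    proof (intro sum.cong refl)
      fix k
      have "sqrt (wt \<bar>real_of_int k\<bar>) > 0" using wt by simp
      then show "c k = 1 / sqrt (wt \<bar>real_of_int k\<bar>) * (sqrt (wt \<bar>real_of_int k\<bar>) * c k)" by simp
    qed
    also have "(\<dots>)\<^sup>2 \<le> (\<Sum>k\<in>J. (1 / sqrt (wt \<bar>real_of_int k\<bar>))\<^sup>2) * (\<Sum>k\<in>J. (sqrt (wt \<bar>real_of_int k\<bar>) * c k)\<^sup>2)"
      by (rule Cauchy_Schwarz_ineq_sum)
    also have "\<dots> = (\<Sum>k\<in>J. 1 / wt \<bar>real_of_int k\<bar>) * (\<Sum>k\<in>J. wt \<bar>real_of_int k\<bar> * (c k)\<^sup>2)"
      using wt by (simp add: power_divide power_mult_distrib less_imp_le)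
    also have "\<dots> \<le> (\<Sum>k\<in>J. 1 / wt \<bar>real_of_int k\<bar>) * ((\<delta> + \<kappa>) / (2 * pi))"
      using wt by (intro mult_left_mono energy sum_nonneg) (auto simp: less_imp_le)
    also have "\<dots> = (\<delta> + \<kappa>) / (2 * pi) * (2 * (\<Sum>k<N. 1 / (real (Suc k) ^ (2 * n) + \<kappa>)))"
      unfolding J_def using sum_nonzero_symmetric_int[of "\<lambda>t. 1 / wt t" N]
      by (simp add: wt_def mult.commute)
    also have "\<dots> \<le> X"
      using lattice_sum_bound[OF n \<delta>, of N] by (simp only: X_def remainder_gap_def \<kappa>_def)
    finally show ?thesis .
  qed
  have X: "X \<ge> 0" using order_trans[OF zero_le_power2 sum_sq] .
  have bound: "cmod (u x) \<le> sqrt X" for x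
    using sum_sq by (intro cmod_le_sum_fourier_coeff u real_le_rsqrt) (simp add: c_def)
  then have "C_norm_torus u \<le> sqrt X"
    unfolding C_norm_torus_def by (intro cSUP_least) auto
  moreover have "0 \<le> C_norm_torus u"
    unfolding C_norm_torus_def
    by (rule order_trans[OF norm_ge_zero cSUP_upper[of 0]]) (use bound in \<open>auto intro!: bdd_aboveI2\<close>)
  ultimately have "(C_norm_torus u)\<^sup>2 \<le> (sqrt X)\<^sup>2" by (rule power_mono)
  then show ?thesis using X by (simp add: X_def)
qed

text \<open>
  A bound for all admissible functions carries over to the supremum in \<open>Theta1\<close> only if there is such a
  function, since \<open>Sup {}\<close> is unspecified on the reals. The two frequencies \<open>1\<close> and \<open>N\<close> suffice as soon as \<open>N\<^sup>2\<^sup>n \<ge> \<delta>\<close>. The squared amplitudes \<open>A\<close> and \<open>B\<close> solve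
  \<open>2 pi (A + B) = 1\<close> and \<open>2 pi (A + B N\<^sup>2\<^sup>n) = \<delta>\<close>.
\<close>

lemma admissible_function_exists:
  fixes n :: nat and \<delta> :: real
  assumes n: "n \<ge> 1" and \<delta>: "\<delta> \<ge> 1"
  obtains u where "u \<in> H_torus n" "u \<in> C_torus" "integral\<^sup>L torus_measure u = 0"
    "L2_norm_torus u = 1" "(L2_norm_torus (frac_laplacian n u))\<^sup>2 = \<delta>"
proof -
  define N where "N = nat \<lceil>\<delta>\<rceil> + 1"
  have N: "N \<ge> 2" "real N \<ge> \<delta>" using \<delta> unfolding N_def by linarith+
  define P where "P = real N ^ (2 * n)"
  have "real N ^ 1 \<le> P" unfolding P_def using N n by (intro power_increasing) auto
  then have P: "P \<ge> \<delta>" "P > 1" using N by auto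
  define B where "B = (\<delta> - 1) / (2 * pi * (P - 1))"
  define A where "A = 1 / (2 * pi) - B"
  have B: "B \<ge> 0" using \<delta> P by (simp add: B_def)
  have BP: "2 * pi * (B * (P - 1)) = \<delta> - 1" using P by (simp add: B_def)
  have "2 * pi * B \<le> 1" using P \<delta> by (simp add: B_def)
  then have A: "A \<ge> 0" by (simp add: A_def field_simps)
  define c where "c k = complex_of_real (if k = 1 then sqrt A else sqrt B)" for k :: int
  define d where "d k = of_int (\<bar>k\<bar> ^ n) * c k" for k
  define K where "K = {1, int N}"
  have K: "finite K" "1 \<noteq> int N" using N by (auto simp: K_def)
  define u where "u = trig_poly K c"
  define w where "w = trig_poly K d"
  have uC: "u \<in> C_torus" and wC: "w \<in> C_torus" by (simp_all add: u_def w_def trig_poly_C_torus)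
  have lap: "is_frac_laplacian n u w"
    using wC C_torus_subset_L2 K
    by (auto simp: is_frac_laplacian_def u_def w_def d_def fourier_coeff_trig_poly)
  have uH: "u \<in> H_torus n" using lap uC C_torus_subset_L2 by (auto simp: H_torus_def)
  have "fourier_coeff u 0 = 0" using K N by (simp add: u_def fourier_coeff_trig_poly K_def)
  then have mean: "integral\<^sup>L torus_measure u = 0" by (simp add: fourier_coeff_def)
  have "(L2_norm_torus u)\<^sup>2 = 2 * pi * (A + B)"
    using K A B by (simp add: u_def L2_norm_trig_poly) (simp add: K_def c_def)
  then have norm_sq: "(L2_norm_torus u)\<^sup>2 = 1" by (simp add: A_def)
  have norm_u: "L2_norm_torus u = 1"
    using norm_sq by (simp add: L2_norm_torus_def)
  have "(L2_norm_torus w)\<^sup>2 = 2 * pi * (A + B * P)"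
    using K A B by (simp add: w_def L2_norm_trig_poly)
      (simp add: K_def c_def d_def P_def norm_mult norm_power power_mult_distrib power_mult mult.commute)
  also have "\<dots> = 2 * pi * (A + B) + 2 * pi * (B * (P - 1))" by (simp add: algebra_simps)
  also have "\<dots> = \<delta>" unfolding BP by (simp add: A_def)
  finally have "(L2_norm_torus w)\<^sup>2 = \<delta>" .
  moreover have "L2_norm_torus (frac_laplacian n u) = L2_norm_torus w"
    using frac_laplacian_props[OF uH] lap by (intro L2_norm_torus_eqI) (auto simp: is_frac_laplacian_def)
  ultimately show thesis using that[OF uH uC mean norm_u] by simp
qed

theorem lemma5p8:
  fixes n :: nat
  assumes "n \<ge> 1"
  shows "K1 n > 0"
proof -
  have "remainder_gap n > 0" using assms by (simp add: remainder_gap_def)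
  also have "remainder_gap n \<le> K1 n"
    unfolding K1_def
  proof (rule cINF_greatest)
    fix \<delta> :: real assume "\<delta> \<in> {1..}"
    then have \<delta>: "\<delta> \<ge> 1" by simp
    have "Theta1 n \<delta> \<le> c1 n * \<delta> powr (1 / (2 * real n)) - remainder_gap n"
      unfolding Theta1_def
    proof (rule cSup_least)
      show "{(C_norm_torus u)\<^sup>2 | u. u \<in> H_torus n \<and> u \<in> C_torus \<and> integral\<^sup>L torus_measure u = 0 \<and>
          L2_norm_torus u = 1 \<and> (L2_norm_torus (frac_laplacian n u))\<^sup>2 = \<delta>} \<noteq> {}"
        using admissible_function_exists[OF assms \<delta>] by blast
    qed (use C_norm_bound[OF assms \<delta>] in blast)
    then show "remainder_gap n \<le> c1 n * \<delta> powr (1 / (2 * real n)) - Theta1 n \<delta>" by linarith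
  qed simp
  finally show ?thesis .
qed

end
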